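(* Let $\mathbb{A}=(A,(\mathrm{Con}_i)_{i\in A},(\vDash_i)_{i\in A})$ be a continuous information frame and $\mathbf t\notin A$. Set $\overline A=A\cup\{\mathbf t\}$; for $a\in A$ let $\overline{\mathrm{Con}}_a=\mathrm{Con}_a\cup\{X\cup\{\mathbf t\}:X\in\mathrm{Con}_a\}$, and let $\overline{\mathrm{Con}}_{\mathbf t}=\{\{\mathbf t\},\emptyset\}$; for $a\in\overline A$, $X\in\overline{\mathrm{Con}}_a$ and $c\in\overline A$ let $X\mathrel{\overline\vDash}_a c$ iff either ($a\neq\mathbf t$, $c\neq\mathbf t$ and $X\setminus\{\mathbf t\}\vDash_a c$) or ($a=\mathbf t$ or $c=\mathbf t$, and $c=\mathbf t$). Then $\mathcal W(\mathbb A)=(\overline A,(\overline{\mathrm{Con}}_i)_{i\in\overline A},(\mathrel{\overline\vDash}_i)_{i\in\overline A})$ is a continuous information frame with truth element $\mathbf t$.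
   Context: A continuous information frame is a triple $\mathbb{A}=(A,(\mathrm{Con}_i)_{i\in A},(\vDash_i)_{i\in A})$ where $A$ is a set, each $\mathrm{Con}_i$ is a set of finite subsets of $A$, and $\vDash_i\subseteq\mathrm{Con}_i\times A$; write $iRj$ iff $\{i\}\in\mathrm{Con}_j$, and for finite $Y$, $X\vDash_i Y$ iff $X\vDash_i b$ for all $b\in Y$. Required, for all $i,j,a\in A$ and finite $X,Y\subseteq A$: (i) $\{i\}\in\mathrm{Con}_i$; (ii) if $Y\subseteq X\in\mathrm{Con}_i$ then $Y\in\mathrm{Con}_i$; (iii) if $X\in\mathrm{Con}_i$ and $X\vDash_i Y$ then $Y\in\mathrm{Con}_i$; (iv) if $X,Y\in\mathrm{Con}_i$, $X\subseteq Y$ and $X\vDash_i a$ then $Y\vDash_i a$; (v) if $X\in\mathrm{Con}_i$, $X\vDash_i Y$ and $Y\vDash_i a$ then $X\vDash_i a$; (vi) if $iRj$ then $\mathrm{Con}_i\subseteq\mathrm{Con}_j$; (vii) if $iRj$, $X\in\mathrm{Con}_i$ and $X\vDash_i a$ then $X\vDash_j a$; (viii) if $X\vDash_i Y$ then there exist $e\in A$ and $Z\in\mathrm{Con}_e$ with $X\vDash_i \{e\}\cup Z$ and $Z\vDash_e Y$. A token $\mathbf t$ is a truth element if $\emptyset\vDash_i\mathbf t$ for all tokens $i$. *)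

theory Defs
  imports Main
begin

text \<open>The families \<open>con\<close> and \<open>entails\<close> are total functions on the token type; only their values
  at indices in \<open>tokens F\<close> are meaningful.\<close>

record 'a info_frame =
  tokens :: "'a set"
  con :: "'a \<Rightarrow> 'a set set"
  entails :: "'a \<Rightarrow> 'a set \<Rightarrow> 'a \<Rightarrow> bool"

definition index_rel :: "'a info_frame \<Rightarrow> 'a \<Rightarrow> 'a \<Rightarrow> bool" where
  "index_rel F i j \<longleftrightarrow> {i} \<in> con F j"

definition entails_set :: "'a info_frame \<Rightarrow> 'a \<Rightarrow> 'a set \<Rightarrow> 'a set \<Rightarrow> bool" where
  "entails_set F i X Y \<longleftrightarrow> (\<forall>b\<in>Y. entails F i X b)"

text \<open>In \<open>interpolation\<close> the assumption \<open>X \<in> con F i\<close> matters only for \<open>Y = {}\<close>: the entailment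
  relation at \<open>i\<close> has \<open>con F i\<close> as its domain, but \<open>entails_set F i X {}\<close> holds vacuously for
  every \<open>X\<close>.\<close>

locale continuous_information_frame =
  fixes F :: "'a info_frame"
  assumes con_finite_subset:
      "\<lbrakk>i \<in> tokens F; X \<in> con F i\<rbrakk> \<Longrightarrow> finite X \<and> X \<subseteq> tokens F"
    and entails_domain:
      "\<lbrakk>i \<in> tokens F; entails F i X a\<rbrakk> \<Longrightarrow> X \<in> con F i \<and> a \<in> tokens F"
    and self_consistent:
      "i \<in> tokens F \<Longrightarrow> {i} \<in> con F i"
    and con_subset:
      "\<lbrakk>i \<in> tokens F; X \<in> con F i; Y \<subseteq> X\<rbrakk> \<Longrightarrow> Y \<in> con F i"
    and con_entailed:
      "\<lbrakk>i \<in> tokens F; X \<in> con F i; finite Y; Y \<subseteq> tokens F; entails_set F i X Y\<rbrakk>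
        \<Longrightarrow> Y \<in> con F i"
    and entails_weaken:
      "\<lbrakk>i \<in> tokens F; X \<in> con F i; Y \<in> con F i; X \<subseteq> Y; entails F i X a\<rbrakk>
        \<Longrightarrow> entails F i Y a"
    and entails_cut:
      "\<lbrakk>i \<in> tokens F; X \<in> con F i; finite Y; Y \<subseteq> tokens F; entails_set F i X Y; entails F i Y a\<rbrakk>
        \<Longrightarrow> entails F i X a"
    and con_transfer:
      "\<lbrakk>i \<in> tokens F; j \<in> tokens F; index_rel F i j\<rbrakk> \<Longrightarrow> con F i \<subseteq> con F j"
    and entails_transfer:
      "\<lbrakk>i \<in> tokens F; j \<in> tokens F; index_rel F i j; X \<in> con F i; entails F i X a\<rbrakk>
        \<Longrightarrow> entails F j X a"
    and interpolation:
      "\<lbrakk>i \<in> tokens F; X \<in> con F i; finite Y; Y \<subseteq> tokens F; entails_set F i X Y\<rbrakk>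
        \<Longrightarrow> \<exists>e\<in>tokens F. \<exists>Z\<in>con F e. entails_set F i X ({e} \<union> Z) \<and> entails_set F e Z Y"

definition truth_element :: "'a info_frame \<Rightarrow> 'a \<Rightarrow> bool" where
  "truth_element F t \<longleftrightarrow> t \<in> tokens F \<and> (\<forall>i\<in>tokens F. entails F i {} t)"

definition truth_con :: "'a info_frame \<Rightarrow> 'a \<Rightarrow> 'a \<Rightarrow> 'a set set" where
  "truth_con F t a =
    (if a = t then {{t}, {}} else con F a \<union> {X \<union> {t} | X. X \<in> con F a})"

definition truth_entails :: "'a info_frame \<Rightarrow> 'a \<Rightarrow> 'a \<Rightarrow> 'a set \<Rightarrow> 'a \<Rightarrow> bool" where
  "truth_entails F t a X c \<longleftrightarrow>
    a \<in> tokens F \<union> {t} \<and> X \<in> truth_con F t a \<and> c \<in> tokens F \<union> {t} \<and>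
    ((a \<noteq> t \<and> c \<noteq> t \<and> entails F a (X - {t}) c) \<or> ((a = t \<or> c = t) \<and> c = t))"

text \<open>The frame \<open>\<W>(F)\<close>, intended for \<open>t \<notin> tokens F\<close>.\<close>

definition truth_extension :: "'a info_frame \<Rightarrow> 'a \<Rightarrow> 'a info_frame" where
  "truth_extension F t =
    \<lparr>tokens = tokens F \<union> {t}, con = truth_con F t, entails = truth_entails F t\<rparr>"

end

theory Submission
  imports Defs
begin

text \<open>Over an old index \<open>a\<close>, both consistency and entailment of \<open>X\<close> in the extension are
  consistency and entailment of \<open>X - {t}\<close> in \<open>F\<close>, so each axiom reduces to itself in \<open>F\<close>;
  over the new index \<open>t\<close> everything takes place inside \<open>{t}\<close>. The relation \<open>tRj\<close> always holds,
  whereas \<open>iRt\<close> forces \<open>i = t\<close>.\<close>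

lemma tokens_truth_extension [simp]: "tokens (truth_extension F t) = insert t (tokens F)"
  and con_truth_extension [simp]: "con (truth_extension F t) = truth_con F t"
  and entails_truth_extension [simp]: "entails (truth_extension F t) = truth_entails F t"
  by (auto simp: truth_extension_def)

lemma truth_con_new: "X \<in> truth_con F t t \<longleftrightarrow> X \<subseteq> {t}"
  by (auto simp: truth_con_def)

lemma truth_entails_new: "truth_entails F t t X c \<longleftrightarrow> X \<subseteq> {t} \<and> c = t"
  by (auto simp: truth_entails_def truth_con_new)

context continuous_information_frame
begin

text \<open>Members of \<open>con F a\<close> consist of tokens of \<open>F\<close>, so they miss
  \<open>t\<close>; deleting \<open>t\<close> from \<open>Y\<close> or \<open>Y \<union> {t}\<close>
  therefore gives back the same \<open>Y\<close>.\<close>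

lemma truth_con_old:
  assumes "t \<notin> tokens F" "a \<in> tokens F"
  shows "X \<in> truth_con F t a \<longleftrightarrow> X - {t} \<in> con F a"
proof -
  have "a \<noteq> t" using assms by auto
  have no_t: "Y - {t} = Y" if "Y \<in> con F a" for Y
    using con_finite_subset[OF assms(2) that] assms(1) by auto
  show ?thesis
  proof
    assume "X \<in> truth_con F t a"
    then obtain Y where "Y \<in> con F a" "X = Y \<or> X = Y \<union> {t}"
      using \<open>a \<noteq> t\<close> by (auto simp: truth_con_def)
    moreover from this have "X - {t} = Y" using no_t by auto
    ultimately show "X - {t} \<in> con F a" by simp
  next
    assume "X - {t} \<in> con F a"
    moreover have "X = X - {t} \<or> X = (X - {t}) \<union> {t}" by auto
    ultimately have "X \<in> con F a \<or> (\<exists>Y. X = Y \<union> {t} \<and> Y \<in> con F a)"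
      by metis
    then show "X \<in> truth_con F t a"
      using \<open>a \<noteq> t\<close> by (auto simp: truth_con_def)
  qed
qed

text \<open>By \<open>entails_domain\<close>, an entailment in \<open>F\<close> already makes
  \<open>c\<close> a token, hence different from \<open>t\<close>; the side conditions on
  \<open>c\<close> are thus absorbed.\<close>

lemma truth_entails_old:
  assumes "t \<notin> tokens F" "a \<in> tokens F"
  shows "truth_entails F t a X c \<longleftrightarrow> X - {t} \<in> con F a \<and> (c = t \<or> entails F a (X - {t}) c)"
  using assms entails_domain[OF assms(2)]
  by (auto simp: truth_entails_def truth_con_old)

text \<open>Any consistent \<open>X\<close> entails \<open>t\<close>, so only \<open>Y - {t}\<close>
  imposes a condition. Consistency of \<open>X\<close> is assumed because for \<open>Y = {t}\<close>
  the right side is vacuous while the left side demands it.\<close>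

lemma truth_entails_set_old:
  assumes "t \<notin> tokens F" "a \<in> tokens F" "X \<in> truth_con F t a"
  shows "entails_set (truth_extension F t) a X Y \<longleftrightarrow> entails_set F a (X - {t}) (Y - {t})"
  using assms by (auto simp: entails_set_def truth_entails_old truth_con_old)

lemma empty_consistent: "i \<in> tokens F \<Longrightarrow> {} \<in> con F i"
  using con_subset self_consistent by blast

lemma index_rel_truth_extension:
  assumes "t \<notin> tokens F" "index_rel (truth_extension F t) i j"
    and "i \<in> insert t (tokens F)" "j \<in> insert t (tokens F)"
  shows "i = t \<or> i \<in> tokens F \<and> j \<in> tokens F \<and> index_rel F i j"
proof (cases "i = t")
  case False
  then have "{i} - {t} = {i}" by auto
  then show ?thesis
    using assms False by (auto simp: index_rel_def truth_con_new truth_con_old)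
qed simp

lemma continuous_information_frame_truth_extension:
  assumes t: "t \<notin> tokens F"
  shows "continuous_information_frame (truth_extension F t)"
proof (unfold_locales, unfold tokens_truth_extension con_truth_extension entails_truth_extension)
  note old = truth_con_old[OF t] truth_entails_old[OF t] truth_entails_set_old[OF t]
  note new = truth_con_new truth_entails_new
  \<comment> \<open>The axioms follow in order of growing hypotheses: first without consistency of
    \<open>X\<close>, then with it, finally with \<open>X\<close> entailing a finite
    \<open>Y\<close>.\<close>
  let ?T = "insert t (tokens F)" and ?W = "truth_extension F t"
  fix i X
  assume i: "i \<in> ?T"
  show "{i} \<in> truth_con F t i"
    using i t self_consistent by (cases "i = t") (auto simp: old new)
  show "X \<in> truth_con F t i \<and> a \<in> ?T" if "truth_entails F t i X a" for a
    using that by (auto simp: truth_entails_def)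
  \<comment> \<open>For \<open>i = t\<close> and \<open>j\<close> old, a consistent set becomes
    empty once \<open>t\<close> is deleted, and \<open>{}\<close> is consistent at every old
    index.\<close>
  show "truth_con F t i \<subseteq> truth_con F t j"
    if "j \<in> ?T" "index_rel ?W i j" for j
    using index_rel_truth_extension[OF t that(2) i that(1)] con_transfer[of i j] that(1) t
    by (cases "i = t"; cases "j = t") (auto simp: old new empty_consistent Diff_eq_empty_iff[THEN iffD2])
  assume X: "X \<in> truth_con F t i"
  show "finite X \<and> X \<subseteq> ?T"
  proof (cases "i = t")
    case True
    then show ?thesis using X by (auto simp: new intro: finite_subset)
  next
    case False
    then show ?thesis
      using con_finite_subset[of i "X - {t}"] i X by (auto simp: old)
  qed
  show "Y \<in> truth_con F t i" if "Y \<subseteq> X" for Y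
  proof (cases "i = t")
    case False
    moreover have "Y - {t} \<subseteq> X - {t}" using that by auto
    ultimately show ?thesis using con_subset[of i "X - {t}"] i X by (auto simp: old)
  qed (use X that in \<open>auto simp: new\<close>)
  show "truth_entails F t i Y a"
    if "Y \<in> truth_con F t i" "X \<subseteq> Y" "truth_entails F t i X a" for Y a
  proof (cases "i = t")
    case False
    moreover have "X - {t} \<subseteq> Y - {t}" using that by auto
    ultimately show ?thesis
      using entails_weaken[of i "X - {t}" "Y - {t}" a] i X that by (auto simp: old)
  qed (use that in \<open>auto simp: new\<close>)
  \<comment> \<open>If \<open>a = t\<close>, only consistency of \<open>X\<close> at
    \<open>j\<close> has to be carried over, which is why \<open>con_transfer\<close> is needed
    besides \<open>entails_transfer\<close>.\<close>
  show "truth_entails F t j X a"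
    if "j \<in> ?T" "index_rel ?W i j" "truth_entails F t i X a" for j a
    using index_rel_truth_extension[OF t that(2) i that(1)] con_transfer[of i j]
      entails_transfer[of i j] that X t
    by (cases "i = t"; cases "j = t") (auto simp: old new empty_consistent Diff_eq_empty_iff[THEN iffD2])
  fix Y
  assume Y: "finite Y" "Y \<subseteq> ?T" and XY: "entails_set ?W i X Y"
  have Y': "finite (Y - {t})" "Y - {t} \<subseteq> tokens F" using Y by auto
  have XY': "entails_set F i (X - {t}) (Y - {t})" "X - {t} \<in> con F i" if "i \<noteq> t"
    using that i X XY by (auto simp: old)
  show "Y \<in> truth_con F t i"
  proof (cases "i = t")
    case True
    then show ?thesis using XY by (auto simp: new entails_set_def)
  next
    case False
    then show ?thesis using con_entailed[OF _ _ Y'] XY' i by (auto simp: old)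
  qed
  show "truth_entails F t i X a" if "truth_entails F t i Y a" for a
  proof (cases "i = t")
    case True
    then show ?thesis using that X by (auto simp: new)
  next
    case False
    then show ?thesis using entails_cut[OF _ _ Y'] XY' i that by (auto simp: old)
  qed
  show "\<exists>e\<in>?T. \<exists>Z\<in>truth_con F t e. entails_set ?W i X ({e} \<union> Z) \<and> entails_set ?W e Z Y"
  proof (cases "i = t")
    case True
    \<comment> \<open>Here \<open>Y \<subseteq> {t}\<close>, so the interpolant can be
      \<open>e = t\<close> with \<open>Z = {}\<close>.\<close>
    then have "entails_set ?W i X ({t} \<union> {})" "entails_set ?W t {} Y" "{} \<in> truth_con F t t"
      using X XY by (auto simp: new entails_set_def)
    then show ?thesis by blast
  next
    case False
    \<comment> \<open>The interpolant for \<open>Y - {t}\<close> in \<open>F\<close> also serves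
      \<open>Y\<close>: if \<open>t\<close> lies in \<open>Y\<close>, it is entailed at
      \<open>e\<close> by the consistent set \<open>Z\<close>.\<close>
    then obtain e Z where e: "e \<in> tokens F" "Z \<in> con F e"
        and ent: "entails_set F i (X - {t}) ({e} \<union> Z)" "entails_set F e Z (Y - {t})"
      using interpolation[OF _ _ Y'] XY' i by blast
    have Z: "Z - {t} = Z" using con_finite_subset[OF e] t by auto
    then have "Z \<in> truth_con F t e" using e by (simp add: old)
    moreover have "entails_set ?W i X ({e} \<union> Z)"
      using ent(1) False i X by (auto simp: old entails_set_def)
    moreover have "entails_set ?W e Z Y"
      using ent(2) e Z calculation(1) by (simp add: old)
    ultimately show ?thesis using e by blast
  qed
qed

text \<open>Entailing \<open>t\<close> at an index takes no more than consistency there, and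
  \<open>{}\<close> is consistent at all indices.\<close>

lemma truth_element_truth_extension:
  assumes "t \<notin> tokens F"
  shows "truth_element (truth_extension F t) t"
  using assms
  by (auto simp: truth_element_def truth_entails_new truth_entails_old empty_consistent)

end

theorem theorem6p1:
  fixes F :: "'a info_frame" and t :: 'a
  assumes "continuous_information_frame F"
    and "t \<notin> tokens F"
  shows "continuous_information_frame (truth_extension F t) \<and> truth_element (truth_extension F t) t"
  using continuous_information_frame.continuous_information_frame_truth_extension[OF assms]
    continuous_information_frame.truth_element_truth_extension[OF assms] by simp

end
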